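(* Let $\mathcal P\subset\mathbb R^n$ be an $n$-dimensional convex polytope and consider $\dot x=Ax+a+Bu$, $x\in\mathcal P$, with $A\in\mathbb R^{n\times n}$, $a\in\mathbb R^n$, $B\in\mathbb R^{n\times m}$. Assume (A1) $\operatorname{rank}(B)=n-1$; (A2) $(A,B)$ is controllable; (A3) $\operatorname{int}\mathcal P\cap\mathcal O=\emptyset$; (A4) $\mathcal F$ is an $(n-1)$-dimensional polytope contained in the boundary of $\mathcal P$. Then $\mathcal P\xrightarrow{\mathcal P}\mathcal F$ if and only if (a) $\mathcal H^-\setminus(\mathcal F\cup\mathcal B^-)=\emptyset$, and (b) $\mathcal P^+\not\subset \mathcal O\cap\{x\in\mathcal P:\beta^Tx>\beta^Tv^+\}$.
   Context: Controls $u:t\mapsto u(t)\in\mathbb R^m$ are piecewise continuous; $\phi^u_t(x_0)$ denotes the solution from $x_0$. For closed sets $\Omega,\Omega_f$ and $x\in\Omega$, $x\xrightarrow{\Omega}\Omega_f$ means there exist a piecewise continuous control $u$ and $T\ge 0$ with $\phi^u_T(x)\in\Omega_f$ and $\phi^u_t(x)\in\Omega$ for all $t\in[0,T]$; for a set $\Omega'\subseteq\Omega$, $\Omega'\xrightarrow{\Omega}\Omega_f$ means $x\xrightarrow{\Omega}\Omega_f$ for every $x\in\Omega'$. Let $\mathcal B=\operatorname{Im}(B)$ and $\mathcal O=\{x\in\mathbb R^n: Ax+a\in\mathcal B\}$. Let $\beta$ be the unit normal vector to $\mathcal B$ such that $\beta^T(Ax+a)\le 0$ for all $x\in\mathcal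 P$. For $z\in\mathbb R^n$ let $\mathcal B_z=\{x\in\mathbb R^n:\beta^Tx=\beta^Tz\}$. Let $v^-\in\arg\min\{\beta^Tx:x\in\mathcal F\}$, $v^+\in\arg\max\{\beta^Tx:x\in\mathcal F\}$, $\mathcal H^-=\{x\in\mathcal P:\beta^Tx\le\beta^Tv^-\}$, $\mathcal P^+=\arg\max\{\beta^Tx:x\in\mathcal P\}$, and $\mathcal B^-=\mathcal B_{v^-}\cap\mathcal O$ if $\mathcal B_{v^-}\cap\mathcal O\cap\mathcal F\neq\emptyset$, and $\mathcal B^-=\emptyset$ otherwise. *)

theory Defs
  imports "HOL-Analysis.Analysis"
begin

text \<open>Piecewise continuous control: on every compact interval there are only finitely
  many discontinuity points, and at each of them the one-sided limits exist.\<close>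
definition piecewise_continuous :: "(real \<Rightarrow> 'b::real_normed_vector) \<Rightarrow> bool" where
  "piecewise_continuous u \<longleftrightarrow>
     (\<forall>a b. \<exists>S. finite S \<and>
        (\<forall>t\<in>{a..b} - S. isCont u t) \<and>
        (\<forall>s\<in>S. (\<exists>l. (u \<longlongrightarrow> l) (at_left s)) \<and> (\<exists>r. (u \<longlongrightarrow> r) (at_right s))))"

text \<open>x is the solution of x' = A x + a + B u on [0,T] starting at x0
  (in integral/Caratheodory form, appropriate for piecewise continuous u).\<close>
definition is_solution ::
  "real^'n^'n \<Rightarrow> real^'n \<Rightarrow> real^'m^'n \<Rightarrow> (real \<Rightarrow> real^'m) \<Rightarrow> real^'n \<Rightarrow> real
     \<Rightarrow> (real \<Rightarrow> real^'n) \<Rightarrow> bool" where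
  "is_solution A a B u x0 T x \<longleftrightarrow>
     continuous_on {0..T} x \<and> x 0 = x0 \<and>
     (\<forall>t\<in>{0..T}. ((\<lambda>s. A *v x s + a + B *v u s) has_integral (x t - x0)) {0..t})"

text \<open>x0 \<longrightarrow>_Omega Omega_f\<close>
definition reach ::
  "real^'n^'n \<Rightarrow> real^'n \<Rightarrow> real^'m^'n \<Rightarrow> real^'n \<Rightarrow> (real^'n) set \<Rightarrow> (real^'n) set \<Rightarrow> bool" where
  "reach A a B x0 \<Omega> \<Omega>f \<longleftrightarrow>
     (\<exists>u T x. piecewise_continuous u \<and> T \<ge> 0 \<and> is_solution A a B u x0 T x \<and>
        x T \<in> \<Omega>f \<and> (\<forall>t\<in>{0..T}. x t \<in> \<Omega>))"

definition reach_set ::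
  "real^'n^'n \<Rightarrow> real^'n \<Rightarrow> real^'m^'n \<Rightarrow> (real^'n) set \<Rightarrow> (real^'n) set \<Rightarrow> (real^'n) set \<Rightarrow> bool" where
  "reach_set A a B \<Omega>' \<Omega> \<Omega>f \<longleftrightarrow> (\<forall>x\<in>\<Omega>'. reach A a B x \<Omega> \<Omega>f)"

text \<open>Controllability of (A,B): Kalman rank condition, i.e. the columns of
  [B, AB, ..., A^(n-1) B] span R^n.\<close>
definition controllable :: "real^'n^'n \<Rightarrow> real^'m^'n \<Rightarrow> bool" where
  "controllable A B \<longleftrightarrow>
     span (\<Union>k<CARD('n). range (\<lambda>v. (((*v) A) ^^ k) (B *v v))) = (UNIV :: (real^'n) set)"

end

theory Submission
  imports Defs
begin

text \<open>Put \<open>drift x = \<beta> \<bullet> (A x + a)\<close>. Since the image of \<open>B\<close> is the hyperplane orthogonal to \<open>\<beta>\<close>, a smooth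
  path is a trajectory iff its height \<open>\<beta> \<bullet> x\<close> has derivative \<open>drift x \<le> 0\<close>; within a level set of \<open>\<beta>\<close>
  one moves at will. Hence a point at or below the bottom level of \<open>F\<close> reaches \<open>F\<close> only inside a level set of
  equilibria (condition (a)). If the drift vanishes on the top face \<open>P\<^sup>+\<close>, Gronwall's inequality traps trajectories
  there (condition (b)). Conversely, every level strictly between the extreme ones contains an interior
  point, where the drift is negative. A straight segment then descends between two points of negative
  drift in finite time, and a path tangent to the level set leaves or reaches a point of zero
  drift in finite time.\<close>

subsection \<open>Concatenation of trajectories\<close>

text \<open>Testing the definition on the one-point interval \<open>{s..s}\<close> gives one-sided
  limits at every \<open>s\<close>, since a point outside the exceptional set is one of continuity.
  The set may then be enlarged freely, which splicing needs.\<close>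

lemma piecewise_continuous_iff:
  "piecewise_continuous u \<longleftrightarrow>
     (\<forall>a b. \<exists>S. finite S \<and> (\<forall>t\<in>{a..b} - S. isCont u t)) \<and>
     (\<forall>s. (\<exists>l. (u \<longlongrightarrow> l) (at_left s)) \<and> (\<exists>r. (u \<longlongrightarrow> r) (at_right s)))"
    (is "_ \<longleftrightarrow> ?C \<and> ?L")
proof
  assume u: "piecewise_continuous u"
  have "(\<exists>l. (u \<longlongrightarrow> l) (at_left s)) \<and> (\<exists>r. (u \<longlongrightarrow> r) (at_right s))" for s
  proof -
    obtain S where S: "\<forall>t\<in>{s..s} - S. isCont u t"
      "\<forall>s\<in>S. (\<exists>l. (u \<longlongrightarrow> l) (at_left s)) \<and> (\<exists>r. (u \<longlongrightarrow> r) (at_right s))"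
      using u unfolding piecewise_continuous_def by meson
    show ?thesis
    proof (cases "s \<in> S")
      case False
      then have "u \<midarrow>s\<rightarrow> u s"
        using S(1) by (simp add: isCont_def)
      then show ?thesis
        by (auto simp: filterlim_at_split)
    qed (use S in auto)
  qed
  moreover have ?C
    using u unfolding piecewise_continuous_def by meson
  ultimately show "?C \<and> ?L" by blast
next
  assume "?C \<and> ?L"
  then show "piecewise_continuous u"
    unfolding piecewise_continuous_def by meson
qed

lemma continuous_imp_piecewise_continuous:
  assumes "\<And>t. isCont u t"
  shows "piecewise_continuous u"
  unfolding piecewise_continuous_def using assms by (intro allI exI[of _ "{}"]) auto

lemma piecewise_continuous_switch:
  fixes u v :: "real \<Rightarrow> 'b::real_normed_vector"
  assumes u: "piecewise_continuous u" and v: "piecewise_continuous v"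
  shows "piecewise_continuous (\<lambda>t. if t \<le> c then u t else v (t - c))"
proof -
  let ?w = "\<lambda>t. if t \<le> c then u t else v (t - c)"
  have left: "\<forall>\<^sub>F t in nhds s. ?w t = u t" if "s < c" for s
    using eventually_nhds_in_open[of "{..<c}" s] that by (auto elim!: eventually_mono)
  have right: "\<forall>\<^sub>F t in nhds s. ?w t = v (t - c)" if "s > c" for s
    using eventually_nhds_in_open[of "{c<..}" s] that by (auto elim!: eventually_mono)
  have at_c: "\<forall>\<^sub>F t in at_left c. ?w t = u t" "\<forall>\<^sub>F t in at_right c. ?w t = v (t - c)"
    by (auto simp: eventually_at_filter)
  have shift: "(\<exists>l. ((\<lambda>t. v (t - c)) \<longlongrightarrow> l) (at_left s)) \<and> (\<exists>r. ((\<lambda>t. v (t - c)) \<longlongrightarrow> r) (at_right s))" for s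
  proof -
    have lims: "filterlim (\<lambda>t. t - c) (at_left (s - c)) (at_left s)"
      "filterlim (\<lambda>t. t - c) (at_right (s - c)) (at_right s)"
      unfolding filterlim_at
      by (auto intro!: tendsto_intros simp: eventually_at_filter)
    obtain l r where "(v \<longlongrightarrow> l) (at_left (s - c))" "(v \<longlongrightarrow> r) (at_right (s - c))"
      using v unfolding piecewise_continuous_iff by blast
    then show ?thesis
      using filterlim_compose[OF _ lims(1)] filterlim_compose[OF _ lims(2)] by blast
  qed
  have "\<exists>S. finite S \<and> (\<forall>t\<in>{a..b} - S. isCont ?w t)" for a b
  proof -
    obtain S where S: "finite S" "\<forall>t\<in>{a..b} - S. isCont u t"
      using u unfolding piecewise_continuous_iff by meson
    obtain S' where S': "finite S'" "\<forall>t\<in>{a - c..b - c} - S'. isCont v t"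
      using v unfolding piecewise_continuous_iff by meson
    \<comment> \<open>\<open>c\<close> is excluded because no matching of \<open>u\<close> and
      \<open>v\<close> is assumed there.\<close>
    let ?S = "insert c (S \<union> (\<lambda>t. t + c) ` S')"
    have "isCont ?w t" if t: "t \<in> {a..b} - ?S" for t
    proof (cases "t < c")
      case True
      then show ?thesis
        using isCont_cong[OF left[OF True]] S(2) t by auto
    next
      case False
      then have "c < t" using t by auto
      moreover have "t - c \<notin> S'"
        using t by force
      then have "isCont v (t - c)"
        using S'(2) t by auto
      then have "isCont (\<lambda>t. v (t - c)) t"
        using isCont_o2[where f = "\<lambda>t. t - c" and g = v] by simp
      ultimately show ?thesis
        using isCont_cong[OF right[of t]] by simp
    qed
    then show ?thesis
      using S(1) S'(1) by (intro exI[of _ ?S]) auto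
  qed
  moreover have "(\<exists>l. (?w \<longlongrightarrow> l) (at_left s)) \<and> (\<exists>r. (?w \<longlongrightarrow> r) (at_right s))" for s
  proof -
    have lim_cong: "(\<exists>l. (?w \<longlongrightarrow> l) G) \<longleftrightarrow> (\<exists>l. (f \<longlongrightarrow> l) G)" if "\<forall>\<^sub>F t in G. ?w t = f t" for f G
      using tendsto_cong[OF that] by simp
    have u_lim: "\<exists>l. (u \<longlongrightarrow> l) (at_left s)" "\<exists>l. (u \<longlongrightarrow> l) (at_right s)"
      using u unfolding piecewise_continuous_iff by blast+
    have nhds_at: "(\<forall>\<^sub>F t in at_left s. ?w t = f t) \<and> (\<forall>\<^sub>F t in at_right s. ?w t = f t)"
      if "\<forall>\<^sub>F t in nhds s. ?w t = f t" for f
      using that by (simp add: eventually_at_filter eventually_mono)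
    consider "s < c" | "s = c" | "c < s" by linarith
    then show ?thesis
    proof cases
      case 1
      show ?thesis
        using nhds_at[OF left[OF 1]] u_lim lim_cong[where G = "at_left s" and f = u] lim_cong[where G = "at_right s" and f = u] by simp
    next
      case 2
      show ?thesis
        using at_c u_lim(1) shift[of s] lim_cong[where G = "at_left s" and f = u] lim_cong[where G = "at_right s" and f = "\<lambda>t. v (t - c)"] 2
        by simp
    next
      case 3
      show ?thesis
        using nhds_at[OF right[OF 3]] shift[of s] lim_cong[where G = "at_left s" and f = "\<lambda>t. v (t - c)"]
          lim_cong[where G = "at_right s" and f = "\<lambda>t. v (t - c)"] by simp
    qed
  qed
  ultimately show ?thesis
    unfolding piecewise_continuous_iff by blast
qed

lemma reach_refl:
  assumes "x0 \<in> \<Omega>" "x0 \<in> \<Omega>f"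
  shows "reach A a B x0 \<Omega> \<Omega>f"
proof -
  have "piecewise_continuous (\<lambda>t. 0)"
    by (rule continuous_imp_piecewise_continuous) simp
  moreover have "is_solution A a B (\<lambda>t. 0) x0 0 (\<lambda>t. x0)"
    by (auto simp: is_solution_def)
  ultimately show ?thesis
    unfolding reach_def using assms by (intro exI[of _ "\<lambda>t. 0"] exI[of _ 0] exI[of _ "\<lambda>t. x0"]) auto
qed

lemma reach_mono:
  assumes "reach A a B x0 \<Omega> \<Omega>f" "\<Omega>f \<subseteq> \<Omega>f'"
  shows "reach A a B x0 \<Omega> \<Omega>f'"
  using assms unfolding reach_def by blast

text \<open>The second clock restarts at time \<open>T\<close>. The states agree there, so the
  spliced path is continuous; the controls need not agree.\<close>

lemma reach_trans:
  assumes "reach A a B x0 \<Omega> {x1}" and "reach A a B x1 \<Omega> \<Omega>f"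
  shows "reach A a B x0 \<Omega> \<Omega>f"
proof -
  obtain u T x where u: "piecewise_continuous u" and T: "T \<ge> 0"
    and x: "is_solution A a B u x0 T x" "x T = x1" "\<forall>t\<in>{0..T}. x t \<in> \<Omega>"
    using assms(1) unfolding reach_def by auto
  obtain v S y where v: "piecewise_continuous v" and S: "S \<ge> 0"
    and y: "is_solution A a B v x1 S y" "y S \<in> \<Omega>f" "\<forall>t\<in>{0..S}. y t \<in> \<Omega>"
    using assms(2) unfolding reach_def by auto
  let ?w = "\<lambda>t. if t \<le> T then u t else v (t - T)"
  let ?z = "\<lambda>t. if t \<le> T then x t else y (t - T)"
  let ?f = "\<lambda>s. A *v ?z s + a + B *v ?w s"
  have y0: "y 0 = x T"
    using y x by (simp add: is_solution_def)
  have "continuous_on ({0..T} \<union> {T..T + S}) ?z"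
    using x(1) y(1) y0
    by (intro continuous_on_If)
      (auto simp: is_solution_def intro!: continuous_on_compose2[where g = y and t = "{0..S}"]
        continuous_intros)
  moreover have "{0..T} \<union> {T..T + S} = {0..T + S}"
    using T S by auto
  ultimately have cont: "continuous_on {0..T + S} ?z" by simp
  have before: "(?f has_integral (?z t - x0)) {0..t}" if t: "t \<in> {0..T}" for t
  proof -
    have "((\<lambda>s. A *v x s + a + B *v u s) has_integral (x t - x0)) {0..t}"
      using x(1) t by (auto simp: is_solution_def)
    then have "(?f has_integral (x t - x0)) {0..t}"
      by (rule has_integral_eq[rotated]) (use t in auto)
    then show ?thesis using t by simp
  qed
  have "(?f has_integral (?z t - x0)) {0..t}" if t: "t \<in> {0..T + S}" for t
  proof (cases "t \<le> T")
    case True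
    then show ?thesis using before t by auto
  next
    case False
    have "((\<lambda>s. A *v y s + a + B *v v s) has_integral (y (t - T) - x1)) {0..t - T}"
      using y(1) t False by (auto simp: is_solution_def)
    then have "((\<lambda>s. A *v y (s - T) + a + B *v v (s - T)) has_integral (y (t - T) - x1)) {T..t}"
      using has_integral_shift_real_ivl[of _ _ 0 "t - T" "-T"] by fastforce
    \<comment> \<open>At time \<open>T\<close> the spliced control still takes the value of
      \<open>u\<close>; a single point does not affect the integral.\<close>
    then have "(?f has_integral (y (t - T) - x1)) {T..t}"
      by (rule has_integral_spike_finite[of "{T}", rotated 2]) auto
    moreover have "(?f has_integral (?z T - x0)) {0..T}"
      using before T by auto
    ultimately show ?thesis
      using has_integral_combine[of 0 T t ?f] T False x(2) by fastforce
  qed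
  moreover have "?z 0 = x0"
    using x(1) T by (auto simp: is_solution_def)
  ultimately have "is_solution A a B ?w x0 (T + S) ?z"
    using cont by (simp add: is_solution_def)
  moreover have "?z (T + S) \<in> \<Omega>f"
    using y(2) S y0 by (cases "S = 0") auto
  moreover have "?z t \<in> \<Omega>" if "t \<in> {0..T + S}" for t
    using x(3) y(3) that by auto
  moreover have "piecewise_continuous ?w"
    using u v by (rule piecewise_continuous_switch)
  ultimately show ?thesis
    unfolding reach_def using T S by (intro exI[of _ ?w] exI[of _ "T + S"] exI[of _ ?z]) auto
qed

subsection \<open>Paths in convex sets\<close>

text \<open>A barycentric combination with weights \<open>1 - p - q\<close>, \<open>p\<close>,
  \<open>q\<close>, written as a displacement from \<open>x\<close> to suit paths that start
  there.\<close>

lemma convex_triangle: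
  fixes \<Omega> :: "'a::real_vector set"
  assumes "convex \<Omega>" "x \<in> \<Omega>" "y \<in> \<Omega>" "z \<in> \<Omega>" "p \<ge> 0" "q \<ge> 0" "p + q \<le> 1"
  shows "x + p *\<^sub>R (y - x) + q *\<^sub>R (z - x) \<in> \<Omega>"
proof -
  have "(1 - p - q) *\<^sub>R x + p *\<^sub>R y + q *\<^sub>R z \<in> convex hull {x, y, z}"
    unfolding convex_hull_3 using assms
    by (intro CollectI exI[of _ "1 - p - q"] exI[of _ p] exI[of _ q]) auto
  then show ?thesis
    using hull_minimal[of "{x, y, z}" \<Omega> convex] assms by (auto simp: algebra_simps)
qed

lemma convex_segment:
  fixes \<Omega> :: "'a::real_vector set"
  assumes "convex \<Omega>" "x \<in> \<Omega>" "z \<in> \<Omega>" "q \<ge> 0" "q \<le> 1"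
  shows "x + q *\<^sub>R (z - x) \<in> \<Omega>"
  using convex_triangle[of \<Omega> x x z 0 q] assms by simp

text \<open>The interior is dense in \<open>P\<close>, so it meets both open half-spaces; being
  connected, it also meets the hyperplane between them.\<close>

lemma convex_interior_level:
  fixes P :: "'a::euclidean_space set"
  assumes "convex P" "interior P \<noteq> {}" "x \<in> P" "y \<in> P" "\<beta> \<bullet> x < c" "c < \<beta> \<bullet> y"
  obtains z where "z \<in> interior P" "\<beta> \<bullet> z = c"
proof -
  have "P \<subseteq> closure (interior P)"
    using convex_closure_interior[OF assms(1,2)] closure_subset by auto
  then have "interior P \<inter> {z. \<beta> \<bullet> z < c} \<noteq> {}" "interior P \<inter> {z. \<beta> \<bullet> z > c} \<noteq> {}"
    using assms open_Int_closure_eq_empty[OF open_halfspace_lt] open_Int_closure_eq_empty[OF open_halfspace_gt]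
    by fastforce+
  then obtain x' y' where "x' \<in> interior P" "\<beta> \<bullet> x' \<le> c" "y' \<in> interior P" "c \<le> \<beta> \<bullet> y'"
    by force
  then show thesis
    using connected_ivt_hyperplane[of "interior P" x' y' \<beta> c] that
    by (meson assms(1) convex_interior convex_connected)
qed

subsection \<open>Inputs of codimension one\<close>

locale codim_one_input =
  fixes A :: "real^'n^'n" and a :: "real^'n" and B :: "real^'m^'n" and \<beta> :: "real^'n"
  assumes range_B: "range (\<lambda>v. B *v v) = {y. \<beta> \<bullet> y = 0}"
begin

section \<open>Height and drift along trajectories\<close>

definition drift :: "real^'n \<Rightarrow> real" where
  "drift x = \<beta> \<bullet> (A *v x + a)"

lemma drift_zero_iff: "drift x = 0 \<longleftrightarrow> A *v x + a \<in> range (\<lambda>v. B *v v)"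
  by (simp add: range_B drift_def)

lemma normal_B [simp]: "\<beta> \<bullet> (B *v v) = 0"
  using range_B by auto

lemma drift_diff: "drift x - drift y = \<beta> \<bullet> (A *v (x - y))"
  by (simp add: drift_def matrix_vector_mult_diff_distrib algebra_simps)

lemma drift_add_triangle:
  "drift (x + p *\<^sub>R (y - x) + q *\<^sub>R (z - x)) = drift x + p * (drift y - drift x) + q * (drift z - drift x)"
  by (simp add: drift_def algebra_simps matrix_vector_right_distrib matrix_vector_mult_diff_distrib
      matrix_vector_mult_scaleR)

lemma drift_segment:
  "drift (x + q *\<^sub>R (z - x)) = drift x + q * (drift z - drift x)"
  using drift_add_triangle[of x 0 x q z] by simp

lemma continuous_on_drift [continuous_intros]:
  assumes "continuous_on S f"
  shows "continuous_on S (\<lambda>t. drift (f t))"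
  unfolding drift_def
  by (intro continuous_intros bounded_linear.continuous_on[OF matrix_vector_mul_bounded_linear] assms)

text \<open>Pairing the integral equation with \<beta> annihilates the control term.\<close>

lemma is_solution_height:
  assumes "is_solution A a B u x0 T x" "t \<in> {0..T}"
  shows "((\<lambda>s. drift (x s)) has_integral (\<beta> \<bullet> x t - \<beta> \<bullet> x0)) {0..t}"
proof -
  have "((\<lambda>s. A *v x s + a + B *v u s) has_integral (x t - x0)) {0..t}"
    using assms by (auto simp: is_solution_def)
  from has_integral_linear[OF this bounded_linear_inner_right[of \<beta>]] show ?thesis
    by (simp add: o_def inner_add_right inner_diff_right drift_def)
qed

text \<open>Velocities along the hyperplane orthogonal to \<open>\<beta>\<close> are unconstrained, so a smooth path is a
  trajectory as soon as its \<open>\<beta>\<close>-component obeys the dynamics.\<close>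
lemma reach_path:
  assumes T: "T \<ge> 0"
    and deriv: "\<And>t. (x has_vector_derivative x' t) (at t)"
    and cont: "\<And>t. isCont x' t"
    and height: "\<And>t. t \<in> {0..T} \<Longrightarrow> \<beta> \<bullet> x' t = drift (x t)"
    and inside: "\<And>t. t \<in> {0..T} \<Longrightarrow> x t \<in> \<Omega>"
  shows "reach A a B (x 0) \<Omega> {x T}"
proof -
  obtain g where g: "linear g" "\<And>y. \<beta> \<bullet> y = 0 \<Longrightarrow> B *v g y = y"
    using linear_exists_right_inverse_on[OF matrix_vector_mul_linear[of B] subspace_UNIV] range_B
    by auto
  \<comment> \<open>\<open>g\<close> inverts \<open>B\<close> on its range and, being linear, keeps
    \<open>u\<close> continuous. The residual is known to lie in that range only on
    \<open>{0..T}\<close>; elsewhere \<open>u\<close> is just a continuous extension.\<close>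
  define u where "u = (\<lambda>t. g (x' t - (A *v x t + a)))"
  have cont_x: "isCont x t" for t
    using deriv has_vector_derivative_continuous by blast
  have "isCont u t" for t
    unfolding u_def
    using g(1) by (intro bounded_linear.isCont[OF matrix_vector_mul_bounded_linear]
        bounded_linear.isCont[of g] isCont_diff isCont_add continuous_const cont cont_x)
      (simp add: linear_conv_bounded_linear)
  then have "piecewise_continuous u"
    by (rule continuous_imp_piecewise_continuous)
  moreover have "is_solution A a B u (x 0) T x"
    unfolding is_solution_def
  proof (intro conjI ballI refl)
    show "continuous_on {0..T} x"
      using cont_x by (simp add: continuous_at_imp_continuous_on)
    fix t assume t: "t \<in> {0..T}"
    have "(x' has_integral (x t - x 0)) {0..t}"
      using t fundamental_theorem_of_calculus[OF _ has_vector_derivative_at_within[OF deriv]] by auto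
    moreover have "x' s = A *v x s + a + B *v u s" if "s \<in> {0..t}" for s
      using g(2)[of "x' s - (A *v x s + a)"] height[of s] t that
      by (simp add: u_def inner_diff_right drift_def)
    ultimately show "((\<lambda>s. A *v x s + a + B *v u s) has_integral (x t - x 0)) {0..t}"
      by (rule has_integral_eq[rotated])
  qed
  ultimately show ?thesis
    unfolding reach_def using T inside by (intro exI[of _ u] exI[of _ T] exI[of _ x]) auto
qed

section \<open>Explicit trajectories within and between levels\<close>

text \<open>The drift is affine, hence zero on the whole segment, so traversing it at constant speed
  respects the height equation.\<close>

lemma reach_level_equilibria:
  assumes "convex \<Omega>" "x \<in> \<Omega>" "y \<in> \<Omega>" "\<beta> \<bullet> x = \<beta> \<bullet> y" "drift x = 0" "drift y = 0"
  shows "reach A a B x \<Omega> {y}"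
proof -
  have "((\<lambda>t. x + t *\<^sub>R (y - x)) has_vector_derivative (y - x)) (at t)" for t
    by (auto intro!: derivative_eq_intros)
  then have "reach A a B (x + 0 *\<^sub>R (y - x)) \<Omega> {x + 1 *\<^sub>R (y - x)}"
    using assms by (intro reach_path[where x' = "\<lambda>t. y - x"]) (auto simp: inner_diff_right drift_segment convex_segment)
  then show ?thesis by simp
qed

text \<open>On the segment the height and the drift are affine, so its parametrisation solves a scalar
  linear equation: the drift grows exponentially from \<open>drift y\<close> to \<open>drift v\<close>.\<close>
lemma reach_descend:
  assumes "convex \<Omega>" and y: "y \<in> \<Omega>" "drift y < 0" and v: "v \<in> \<Omega>" "drift v < 0"
    and lt: "\<beta> \<bullet> v < \<beta> \<bullet> y"
  shows "reach A a B y \<Omega> {v}"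
proof -
  define \<alpha> \<gamma> \<Delta> where "\<alpha> = - drift y" and "\<gamma> = - drift v" and "\<Delta> = \<beta> \<bullet> y - \<beta> \<bullet> v"
  have pos: "\<alpha> > 0" "\<gamma> > 0" "\<Delta> > 0"
    using assms by (auto simp: \<alpha>_def \<gamma>_def \<Delta>_def)
  \<comment> \<open>\<open>q\<close> is the fraction of the segment covered. Its equation says that
    the rate of descent, \<Delta> times the derivative of \<open>q\<close>, is minus the drift,
    which interpolates between \<alpha> and \<gamma>.\<close>
  have path: "reach A a B y \<Omega> {v}"
    if q: "\<And>t. (q has_real_derivative (\<alpha> + (\<gamma> - \<alpha>) * q t) / \<Delta>) (at t)"
      and T: "T \<ge> 0" "q 0 = 0" "q T = 1" "\<And>t. t \<in> {0..T} \<Longrightarrow> 0 \<le> q t \<and> q t \<le> 1" for q T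
  proof -
    let ?x = "\<lambda>t. y + q t *\<^sub>R (v - y)"
    let ?x' = "\<lambda>t. ((\<alpha> + (\<gamma> - \<alpha>) * q t) / \<Delta>) *\<^sub>R (v - y)"
    have "(?x has_vector_derivative ?x' t) (at t)" for t
      by (auto intro!: derivative_eq_intros q)
    moreover have "isCont ?x' t" for t
      using DERIV_isCont[OF q] pos by (intro continuous_intros) auto
    moreover have "\<beta> \<bullet> ?x' t = drift (?x t)" for t
    proof -
      have "\<beta> \<bullet> (v - y) = - \<Delta>"
        by (simp add: \<Delta>_def inner_diff_right)
      then have "\<beta> \<bullet> ?x' t = - (\<alpha> + (\<gamma> - \<alpha>) * q t)"
        using pos by simp
      then show ?thesis
        unfolding drift_segment by (simp add: \<alpha>_def \<gamma>_def algebra_simps)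
    qed
    ultimately have "reach A a B (?x 0) \<Omega> {?x T}"
      using T y v \<open>convex \<Omega>\<close> by (intro reach_path[where x' = ?x']) (auto intro: convex_segment)
    then show ?thesis
      using T by simp
  qed
  show ?thesis
  proof (cases "\<gamma> = \<alpha>")
    case True
    show ?thesis
      by (rule path[of "\<lambda>t. \<alpha> / \<Delta> * t" "\<Delta> / \<alpha>"])
        (use True pos in \<open>auto intro!: derivative_eq_intros simp: field_simps\<close>)
  next
    case False
    define \<mu> where "\<mu> = (\<gamma> - \<alpha>) / \<Delta>"
    define q where "q = (\<lambda>t. (\<alpha> * exp (\<mu> * t) - \<alpha>) / (\<gamma> - \<alpha>))"
    \<comment> \<open>The time at which minus the drift, \<open>\<alpha> * exp (\<mu> * t)\<close>,
      has become \<gamma>. It is nonnegative because \<mu> and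
      \<open>ln (\<gamma> / \<alpha>)\<close> have the same sign.\<close>
    define T where "T = ln (\<gamma> / \<alpha>) / \<mu>"
    have \<mu>: "\<mu> \<noteq> 0" using False pos by (simp add: \<mu>_def)
    have expT: "exp (\<mu> * T) = \<gamma> / \<alpha>"
      using \<mu> pos by (simp add: T_def)
    have "(q has_real_derivative (\<alpha> + (\<gamma> - \<alpha>) * q t) / \<Delta>) (at t)" for t
    proof -
      have "(q has_real_derivative \<alpha> * (\<mu> * exp (\<mu> * t)) / (\<gamma> - \<alpha>)) (at t)"
        unfolding q_def using False by (auto intro!: derivative_eq_intros)
      moreover have "\<alpha> * (\<mu> * exp (\<mu> * t)) / (\<gamma> - \<alpha>) = (\<alpha> + (\<gamma> - \<alpha>) * q t) / \<Delta>"
        using False pos by (simp add: \<mu>_def q_def)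
      ultimately show ?thesis by simp
    qed
    moreover have "T \<ge> 0 \<and> (\<forall>t\<in>{0..T}. 0 \<le> q t \<and> q t \<le> 1)"
    \<comment> \<open>The sign of \<mu> decides whether the exponential grows or decays;
      \<open>q\<close> increases in both cases.\<close>
    proof (cases "\<gamma> > \<alpha>")
      case True
      then have "\<mu> > 0" using pos by (simp add: \<mu>_def)
      then have "1 \<le> exp (\<mu> * t) \<and> exp (\<mu> * t) \<le> \<gamma> / \<alpha>" if "t \<in> {0..T}" for t
        using that by (simp flip: expT)
      then have "\<alpha> \<le> \<alpha> * exp (\<mu> * t) \<and> \<alpha> * exp (\<mu> * t) \<le> \<gamma>" if "t \<in> {0..T}" for t
        using that pos by (simp add: pos_le_divide_eq mult.commute[of _ \<alpha>])
      then show ?thesis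
        using True pos \<open>\<mu> > 0\<close> by (auto simp: T_def q_def field_simps)
    next
      case False
      then have less: "\<gamma> < \<alpha>" using \<open>\<gamma> \<noteq> \<alpha>\<close> by simp
      then have "\<mu> < 0" using pos by (simp add: \<mu>_def divide_neg_pos)
      then have "exp (\<mu> * t) \<le> 1 \<and> \<gamma> / \<alpha> \<le> exp (\<mu> * t)" if "t \<in> {0..T}" for t
        using that by (simp add: mult_nonpos_nonneg flip: expT)
      then have "\<alpha> * exp (\<mu> * t) \<le> \<alpha> \<and> \<gamma> \<le> \<alpha> * exp (\<mu> * t)" if "t \<in> {0..T}" for t
        using that pos by (simp add: pos_divide_le_eq mult.commute[of _ \<alpha>])
      moreover have "T \<ge> 0"
        using less pos \<open>\<mu> < 0\<close> by (simp add: T_def divide_nonpos_neg)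
      ultimately show ?thesis
        using less pos by (auto simp: q_def field_simps)
    qed
    moreover have "q 0 = 0" "q T = 1"
      using False pos by (auto simp: q_def expT)
    ultimately show ?thesis
      by (intro path[of q T]) auto
  qed
qed

text \<open>The path \<open>t \<mapsto> x + t r(t) (z - x) + t\<^sup>2 (w - x)\<close> is tangent at \<open>x\<close> to the level set of \<open>\<beta>\<close>; the affine
  \<open>r\<close> is chosen so that the drift balances the rate \<open>2 t \<bar>\<beta> \<bullet> w - \<beta> \<bullet> x\<bar>\<close> of the height. It leaves \<open>x\<close>
  if \<open>w\<close> is lower and, run backwards, arrives at \<open>x\<close> if \<open>w\<close> is higher.\<close>
lemma quadratic_path:
  assumes "convex \<Omega>" and x: "x \<in> \<Omega>" "drift x = 0"
    and z: "z \<in> \<Omega>" "drift z < 0" "\<beta> \<bullet> z = \<beta> \<bullet> x"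
    and w: "w \<in> \<Omega>" "\<beta> \<bullet> w \<noteq> \<beta> \<bullet> x" and "\<epsilon> > 0"
  obtains T :: real and \<xi> \<xi>' where "T > 0" "\<xi> 0 = x"
    "\<And>t. (\<xi> has_vector_derivative \<xi>' t) (at t)" "\<And>t. isCont \<xi>' t"
    "\<And>t. t \<in> {0..T} \<Longrightarrow> \<xi> t \<in> \<Omega>"
    "\<And>t. drift (\<xi> t) = - (2 * t * \<bar>\<beta> \<bullet> w - \<beta> \<bullet> x\<bar>)"
    "\<And>t. \<beta> \<bullet> \<xi> t = \<beta> \<bullet> x + t\<^sup>2 * (\<beta> \<bullet> w - \<beta> \<bullet> x)"
    "\<And>t. \<beta> \<bullet> \<xi>' t = 2 * t * (\<beta> \<bullet> w - \<beta> \<bullet> x)"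
    "T\<^sup>2 * \<bar>\<beta> \<bullet> w - \<beta> \<bullet> x\<bar> < \<epsilon>"
proof -
  define \<Delta> where "\<Delta> = \<bar>\<beta> \<bullet> w - \<beta> \<bullet> x\<bar>"
  \<comment> \<open>Since the drift vanishes at \<open>x\<close>, along \<xi> it is
    \<open>t * r t * drift z + t\<^sup>2 * drift w\<close>; \<open>r\<close> is solved from equating
    this with \<open>- (2 * t * \<Delta>)\<close>.\<close>
  define r where "r = (\<lambda>t. (2 * \<Delta> + t * drift w) / (- drift z))"
  define \<xi> where "\<xi> = (\<lambda>t. x + (t * r t) *\<^sub>R (z - x) + t\<^sup>2 *\<^sub>R (w - x))"
  define \<xi>' where "\<xi>' = (\<lambda>t. (r t + t * (drift w / (- drift z))) *\<^sub>R (z - x) + (2 * t) *\<^sub>R (w - x))"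
  have \<Delta>: "\<Delta> > 0" using w by (simp add: \<Delta>_def)
  have r_cont: "isCont r t" for t
    unfolding r_def using z by (intro continuous_intros) auto
  have r_deriv: "(r has_real_derivative drift w / (- drift z)) (at t)" for t
    unfolding r_def using z by (auto intro!: derivative_eq_intros)
  have "isCont (\<lambda>t. t * r t + t\<^sup>2) 0" "isCont (\<lambda>t. t\<^sup>2 * \<Delta>) 0"
    by (intro continuous_intros r_cont)+
  moreover have "(f \<longlongrightarrow> f 0) (nhds 0)" if "isCont f 0" for f :: "real \<Rightarrow> real"
    using that by (simp add: isCont_def tendsto_at_iff_tendsto_nhds)
  ultimately have "(r \<longlongrightarrow> r 0) (nhds 0)" "((\<lambda>t. t * r t + t\<^sup>2) \<longlongrightarrow> 0) (nhds 0)"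
    "((\<lambda>t. t\<^sup>2 * \<Delta>) \<longlongrightarrow> 0) (nhds 0)"
    using r_cont[of 0] by fastforce+
  \<comment> \<open>Here \<open>drift z < 0\<close> is essential: for small nonnegative
    \<open>t\<close> all weights of \<open>x\<close>, \<open>z\<close>, \<open>w\<close> are
    nonnegative, so the path stays in the triangle.\<close>
  moreover have "r 0 > 0"
    using \<Delta> z by (simp add: r_def divide_pos_neg)
  ultimately have "\<forall>\<^sub>F t in nhds 0. r t > 0 \<and> t * r t + t\<^sup>2 < 1 \<and> t\<^sup>2 * \<Delta> < \<epsilon>"
    using \<open>\<epsilon> > 0\<close> by (intro eventually_conj order_tendstoD[where y = "r 0"] order_tendstoD(2)) auto
  then obtain d where d: "d > 0"
    "\<And>t. dist t 0 < d \<Longrightarrow> r t > 0 \<and> t * r t + t\<^sup>2 < 1 \<and> t\<^sup>2 * \<Delta> < \<epsilon>"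
    unfolding eventually_nhds_metric by blast
  show thesis
  proof
    \<comment> \<open>Halving keeps the closed interval \<open>{0..d / 2}\<close> inside the open
      ball of radius \<open>d\<close>.\<close>
    show "d / 2 > 0" "\<xi> 0 = x"
      using d by (auto simp: \<xi>_def)
    show "(\<xi> has_vector_derivative \<xi>' t) (at t)" for t
      unfolding \<xi>_def \<xi>'_def by (auto intro!: derivative_eq_intros r_deriv simp: algebra_simps)
    show "isCont \<xi>' t" for t
      unfolding \<xi>'_def using z by (intro continuous_intros r_cont) auto
    show "\<xi> t \<in> \<Omega>" if "t \<in> {0..d / 2}" for t
    proof -
      have "dist t 0 < d" using that d(1) by auto
      from d(2)[OF this] show ?thesis
        unfolding \<xi>_def using that assms by (intro convex_triangle) auto
    qed
    have "t * r t * drift z = - (2 * t * \<Delta>) - t\<^sup>2 * drift w" for t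
      using z by (simp add: r_def field_simps power2_eq_square)
    then show "drift (\<xi> t) = - (2 * t * \<bar>\<beta> \<bullet> w - \<beta> \<bullet> x\<bar>)" for t
      unfolding \<xi>_def drift_add_triangle using x by (simp add: \<Delta>_def)
    show "\<beta> \<bullet> \<xi> t = \<beta> \<bullet> x + t\<^sup>2 * (\<beta> \<bullet> w - \<beta> \<bullet> x)" "\<beta> \<bullet> \<xi>' t = 2 * t * (\<beta> \<bullet> w - \<beta> \<bullet> x)" for t
      using z by (simp_all add: \<xi>_def \<xi>'_def inner_simps)
    show "(d / 2)\<^sup>2 * \<bar>\<beta> \<bullet> w - \<beta> \<bullet> x\<bar> < \<epsilon>"
      using d(2)[of "d / 2"] d(1) by (simp add: \<Delta>_def)
  qed
qed

text \<open>A straight descent from an equilibrium never starts, its speed being proportional to the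
  distance covered; the quadratic path does start. The margin \<epsilon> lets the caller keep
  \<open>y\<close> above a target level.\<close>

lemma reach_leave_equilibrium:
  assumes "convex \<Omega>" and x: "x \<in> \<Omega>" "drift x = 0"
    and z: "z \<in> \<Omega>" "drift z < 0" "\<beta> \<bullet> z = \<beta> \<bullet> x"
    and w: "w \<in> \<Omega>" "\<beta> \<bullet> w < \<beta> \<bullet> x" and "\<epsilon> > 0"
  obtains y where "y \<in> \<Omega>" "drift y < 0" "\<beta> \<bullet> x - \<epsilon> < \<beta> \<bullet> y" "\<beta> \<bullet> y < \<beta> \<bullet> x" "reach A a B x \<Omega> {y}"
proof -
  have "\<beta> \<bullet> w \<noteq> \<beta> \<bullet> x" using w by simp
  from quadratic_path[OF assms(1) x z w(1) this \<open>\<epsilon> > 0\<close>] obtain T \<xi> \<xi>' where \<xi>: "T > 0" "\<xi> 0 = x"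
    "\<And>t. (\<xi> has_vector_derivative \<xi>' t) (at t)" "\<And>t. isCont \<xi>' t"
    "\<And>t. t \<in> {0..T} \<Longrightarrow> \<xi> t \<in> \<Omega>"
    "\<And>t. drift (\<xi> t) = - (2 * t * \<bar>\<beta> \<bullet> w - \<beta> \<bullet> x\<bar>)"
    "\<And>t. \<beta> \<bullet> \<xi> t = \<beta> \<bullet> x + t\<^sup>2 * (\<beta> \<bullet> w - \<beta> \<bullet> x)"
    "\<And>t. \<beta> \<bullet> \<xi>' t = 2 * t * (\<beta> \<bullet> w - \<beta> \<bullet> x)"
    "T\<^sup>2 * \<bar>\<beta> \<bullet> w - \<beta> \<bullet> x\<bar> < \<epsilon>"
    by blast
  have "reach A a B (\<xi> 0) \<Omega> {\<xi> T}"
    by (rule reach_path[OF less_imp_le[OF \<xi>(1)] \<xi>(3,4) _ \<xi>(5)]) (use w in \<open>simp add: \<xi>(6,8) algebra_simps\<close>)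
  moreover have "0 < T\<^sup>2 * (\<beta> \<bullet> x - \<beta> \<bullet> w)" "T\<^sup>2 * (\<beta> \<bullet> x - \<beta> \<bullet> w) < \<epsilon>"
    using \<xi>(1,9) w by simp_all
  moreover have "\<beta> \<bullet> \<xi> T = \<beta> \<bullet> x - T\<^sup>2 * (\<beta> \<bullet> x - \<beta> \<bullet> w)"
    by (simp add: \<xi>(7) algebra_simps)
  moreover have "drift (\<xi> T) < 0"
    using \<xi>(1) w by (simp add: \<xi>(6))
  ultimately show thesis
    using \<xi>(1,2) \<xi>(5)[of T] by (intro that[of "\<xi> T"]) simp_all
qed

text \<open>The quadratic path climbs from \<open>x\<close> at the rate opposite to its drift, so it
  becomes a trajectory when time is reversed.\<close>

lemma reach_arrive_equilibrium:
  assumes "convex \<Omega>" and x: "x \<in> \<Omega>" "drift x = 0"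
    and z: "z \<in> \<Omega>" "drift z < 0" "\<beta> \<bullet> z = \<beta> \<bullet> x"
    and w: "w \<in> \<Omega>" "\<beta> \<bullet> x < \<beta> \<bullet> w" and "\<epsilon> > 0"
  obtains y where "y \<in> \<Omega>" "drift y < 0" "\<beta> \<bullet> x < \<beta> \<bullet> y" "\<beta> \<bullet> y < \<beta> \<bullet> x + \<epsilon>" "reach A a B y \<Omega> {x}"
proof -
  have "\<beta> \<bullet> w \<noteq> \<beta> \<bullet> x" using w by simp
  from quadratic_path[OF assms(1) x z w(1) this \<open>\<epsilon> > 0\<close>] obtain T \<xi> \<xi>' where \<xi>: "T > 0" "\<xi> 0 = x"
    "\<And>t. (\<xi> has_vector_derivative \<xi>' t) (at t)" "\<And>t. isCont \<xi>' t"
    "\<And>t. t \<in> {0..T} \<Longrightarrow> \<xi> t \<in> \<Omega>"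
    "\<And>t. drift (\<xi> t) = - (2 * t * \<bar>\<beta> \<bullet> w - \<beta> \<bullet> x\<bar>)"
    "\<And>t. \<beta> \<bullet> \<xi> t = \<beta> \<bullet> x + t\<^sup>2 * (\<beta> \<bullet> w - \<beta> \<bullet> x)"
    "\<And>t. \<beta> \<bullet> \<xi>' t = 2 * t * (\<beta> \<bullet> w - \<beta> \<bullet> x)"
    "T\<^sup>2 * \<bar>\<beta> \<bullet> w - \<beta> \<bullet> x\<bar> < \<epsilon>"
    by blast
  have "((\<lambda>t. T - t) has_real_derivative -1) (at t)" for t
    by (auto intro!: derivative_eq_intros)
  then have "((\<lambda>t. \<xi> (T - t)) has_vector_derivative - \<xi>' (T - t)) (at t)" for t
    using vector_diff_chain_at[of "\<lambda>t. T - t" "-1" t \<xi> "\<xi>' (T - t)"] \<xi>(3)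
    by (simp add: o_def has_real_derivative_iff_has_vector_derivative)
  moreover have "isCont (\<lambda>t. - \<xi>' (T - t)) t" for t
    using isCont_o2[where f = "\<lambda>t. T - t" and g = \<xi>'] \<xi>(4) by (intro isCont_minus) simp
  ultimately have "reach A a B (\<xi> (T - 0)) \<Omega> {\<xi> (T - T)}"
    using \<xi> w by (intro reach_path[where x' = "\<lambda>t. - \<xi>' (T - t)"]) auto
  then show thesis
    using \<xi>(1,2,6,7,9) w \<xi>(5)[of T] by (intro that[of "\<xi> T"]) simp_all
qed

text \<open>Both level sets must contain a non-equilibrium: otherwise \<open>x\<close> cannot be left,
  or \<open>f\<close> cannot be approached in finite time.\<close>
lemma reach_lower_level:
  assumes "convex \<Omega>" and x: "x \<in> \<Omega>" "drift x \<le> 0" and f: "f \<in> \<Omega>" "drift f \<le> 0"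
    and lt: "\<beta> \<bullet> f < \<beta> \<bullet> x"
    and zx: "zx \<in> \<Omega>" "drift zx < 0" "\<beta> \<bullet> zx = \<beta> \<bullet> x"
    and zf: "zf \<in> \<Omega>" "drift zf < 0" "\<beta> \<bullet> zf = \<beta> \<bullet> f"
  shows "reach A a B x \<Omega> {f}"
proof -
  \<comment> \<open>Replace \<open>x\<close> by a point of negative drift that is still above
    \<open>f\<close>; the admissible margin is the whole height difference.\<close>
  obtain y where y: "y \<in> \<Omega>" "drift y < 0" "\<beta> \<bullet> f < \<beta> \<bullet> y" "reach A a B x \<Omega> {y}"
  proof (cases "drift x = 0")
    case True
    then show thesis
      using reach_leave_equilibrium[of \<Omega> x zx f "\<beta> \<bullet> x - \<beta> \<bullet> f"] assms that by auto
  next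
    case False
    then show thesis
      using that[of x] x lt reach_refl[of x \<Omega> "{x}"] by auto
  qed
  moreover have "reach A a B y \<Omega> {f}"
  proof (cases "drift f = 0")
    case True
    then obtain w where "w \<in> \<Omega>" "drift w < 0" "\<beta> \<bullet> f < \<beta> \<bullet> w" "\<beta> \<bullet> w < \<beta> \<bullet> y" "reach A a B w \<Omega> {f}"
      using reach_arrive_equilibrium[of \<Omega> f zf y "\<beta> \<bullet> y - \<beta> \<bullet> f"] assms y by auto
    then show ?thesis
      using reach_descend[of \<Omega> y w] y \<open>convex \<Omega>\<close> reach_trans by blast
  next
    case False
    then show ?thesis
      using reach_descend[of \<Omega> y f] y f \<open>convex \<Omega>\<close> by auto
  qed
  ultimately show ?thesis
    using reach_trans by blast
qed

section \<open>Controllability and level sets of equilibria\<close>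

lemma drift_eq_inner: "drift x = (\<beta> v* A) \<bullet> x + \<beta> \<bullet> a"
  by (simp add: drift_def inner_add_right dot_matrix_vector_mul dot_lmul_matrix)

text \<open>Otherwise the drift vanishes on the entire hyperplane spanned by \<open>F\<close>, so
  \<open>A\<close> maps the orthogonal complement of \<beta> into itself. All the spaces in the
  Kalman condition then stay inside that complement.\<close>

lemma level_set_not_equilibria:
  assumes "controllable A B" and F: "aff_dim F = int CARD('n) - 1" "\<And>x. x \<in> F \<Longrightarrow> \<beta> \<bullet> x = c"
    and "\<beta> \<noteq> 0"
  obtains x where "x \<in> F" "drift x \<noteq> 0"
proof (rule ccontr)
  assume "\<not> thesis"
  with that have equil: "F \<subseteq> {x. (\<beta> v* A) \<bullet> x = - (\<beta> \<bullet> a)}"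
    by (auto simp: drift_eq_inner eq_neg_iff_add_eq_0)
  obtain f where f: "f \<in> F"
    using F(1) by (cases "F = {}") auto
  have "affine hull F = {x. \<beta> \<bullet> x = c}"
  proof (rule affine_dim_equal)
    show "affine hull F \<subseteq> {x. \<beta> \<bullet> x = c}"
      using F(2) by (intro hull_minimal affine_hyperplane) auto
  qed (use F(1) f \<open>\<beta> \<noteq> 0\<close> in \<open>auto simp: affine_hyperplane aff_dim_hyperplane\<close>)
  moreover have "affine hull F \<subseteq> {x. (\<beta> v* A) \<bullet> x = - (\<beta> \<bullet> a)}"
    using equil by (intro hull_minimal affine_hyperplane)
  ultimately have equil_level: "drift x = 0" if "\<beta> \<bullet> x = c" for x
    using that by (auto simp: drift_eq_inner)
  \<comment> \<open>\<open>f + d\<close> and \<open>f\<close> lie on the same level, and the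
    difference of their zero drifts isolates the linear part.\<close>
  have invariant: "\<beta> \<bullet> (A *v d) = 0" if "\<beta> \<bullet> d = 0" for d
    using that drift_diff[of "f + d" f] equil_level F(2)[OF f] by (simp add: inner_add_right)
  have "\<beta> \<bullet> ((((*v) A) ^^ k) (B *v v)) = 0" for k v
    by (induction k) (simp_all add: invariant)
  then have "(\<Union>k<CARD('n). range (\<lambda>v. (((*v) A) ^^ k) (B *v v))) \<subseteq> {y. \<beta> \<bullet> y = 0}"
    by auto
  then have "UNIV \<subseteq> {y. \<beta> \<bullet> y = 0}"
    using assms(1) span_minimal[OF _ subspace_hyperplane] unfolding controllable_def by metis
  then have "\<beta> \<bullet> \<beta> = 0" by blast
  then show False
    using \<open>\<beta> \<noteq> 0\<close> by simp
qed

section \<open>Necessity of the two conditions\<close>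

lemma drift_convex_combination:
  assumes "u + v = 1"
  shows "drift (u *\<^sub>R x + v *\<^sub>R y) = u * drift x + v * drift y"
proof -
  have "\<beta> \<bullet> a = u * (\<beta> \<bullet> a) + v * (\<beta> \<bullet> a)"
    using assms by (simp flip: distrib_right)
  then show ?thesis
    unfolding drift_eq_inner inner_add_right inner_scaleR_right distrib_left by linarith
qed

text \<open>On a polytope the drift is bounded by a multiple of the distance to the top level, so Gronwall's
  inequality keeps a trajectory from ever leaving a top face of equilibria.\<close>
lemma top_face_invariant:
  assumes "polytope P" and x0: "\<And>y. y \<in> P \<Longrightarrow> \<beta> \<bullet> y \<le> \<beta> \<bullet> x0"
    and equil: "\<And>y. y \<in> P \<Longrightarrow> \<beta> \<bullet> y = \<beta> \<bullet> x0 \<Longrightarrow> drift y = 0"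
    and sol: "is_solution A a B u x0 T x" and inside: "\<And>t. t \<in> {0..T} \<Longrightarrow> x t \<in> P"
    and T: "T \<ge> 0"
  shows "\<beta> \<bullet> x T = \<beta> \<bullet> x0"
proof -
  define M where "M = \<beta> \<bullet> x0"
  obtain V where V: "finite V" "P = convex hull V"
    using \<open>polytope P\<close> by (auto simp: polytope_def)
  have V_sub: "V \<subseteq> P"
    by (simp add: V hull_subset)
  \<comment> \<open>A generator on the top level contributes ratio 0, as division by zero yields 0;
    there both sides of \<open>bound_V\<close> vanish. The inserted 0 keeps the maximum over a
    nonempty set.\<close>
  define K where "K = Max (insert 0 ((\<lambda>v. - drift v / (M - \<beta> \<bullet> v)) ` V))"
  have bound_V: "- drift v \<le> K * (M - \<beta> \<bullet> v)" if "v \<in> V" for v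
  proof (cases "\<beta> \<bullet> v = M")
    case True
    then show ?thesis
      using equil V_sub that by (auto simp: M_def)
  next
    case False
    then have "\<beta> \<bullet> v < M"
      using x0[of v] V_sub that by (auto simp: M_def)
    moreover have "- drift v / (M - \<beta> \<bullet> v) \<le> K"
      unfolding K_def using V(1) that by (intro Max_ge) auto
    ultimately show ?thesis
      by (metis pos_divide_le_eq diff_gt_0_iff_gt)
  qed
  \<comment> \<open>Both sides are affine in \<open>y\<close>, so the inequality passes from the
    generators to their hull.\<close>
  have "convex {y. - drift y \<le> K * (M - \<beta> \<bullet> y)}"
  proof (rule convexI)
    fix y z and p q :: real
    assume yz: "y \<in> {y. - drift y \<le> K * (M - \<beta> \<bullet> y)}" "z \<in> {y. - drift y \<le> K * (M - \<beta> \<bullet> y)}"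
      and pq: "0 \<le> p" "0 \<le> q" "p + q = 1"
    have "- drift (p *\<^sub>R y + q *\<^sub>R z) = p * (- drift y) + q * (- drift z)"
      by (simp add: drift_convex_combination pq)
    also have "\<dots> \<le> p * (K * (M - \<beta> \<bullet> y)) + q * (K * (M - \<beta> \<bullet> z))"
      using yz pq by (intro add_mono mult_left_mono) auto
    also have "\<dots> = K * ((p + q) * M - \<beta> \<bullet> (p *\<^sub>R y + q *\<^sub>R z))"
      by (simp add: inner_add_right algebra_simps)
    finally show "p *\<^sub>R y + q *\<^sub>R z \<in> {y. - drift y \<le> K * (M - \<beta> \<bullet> y)}"
      using pq by simp
  qed
  then have bound: "- drift y \<le> K * (M - \<beta> \<bullet> y)" if "y \<in> P" for y
    using hull_minimal[of V "{y. - drift y \<le> K * (M - \<beta> \<bullet> y)}" convex] bound_V V(2) that by blast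
  define I where "I = (\<lambda>t. integral {0..t} (\<lambda>s. drift (x s)))"
  have I: "I t = \<beta> \<bullet> x t - M" if "t \<in> {0..T}" for t
    using is_solution_height[OF sol that] by (simp add: I_def M_def integral_unique)
  have "continuous_on {0..T} (\<lambda>s. drift (x s))"
    using sol by (auto simp: is_solution_def intro: continuous_on_drift)
  then have I_deriv: "(I has_vector_derivative drift (x t)) (at t within {0..T})" if "t \<in> {0..T}" for t
    unfolding I_def using that by (rule integral_has_vector_derivative)
  \<comment> \<open>The bound reads \<open>drift (x t) \<ge> K * I t\<close>, so \<open>I\<close>
    times the integrating factor is nondecreasing from 0. As no point of \<open>P\<close> is above
    the top, \<open>I T\<close> is also nonpositive.\<close>
  have "exp (- K * 0) * I 0 \<le> exp (- K * T) * I T"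
  proof (rule DERIV_nonneg_imp_increasing_open[OF T])
    fix t assume t: "0 < t" "t < T"
    then have "at t within {0..T} = at t"
      by (intro at_within_interior) auto
    with I_deriv[of t] t have "(I has_real_derivative drift (x t)) (at t)"
      by (simp add: has_real_derivative_iff_has_vector_derivative)
    then have "((\<lambda>t. exp (- K * t) * I t) has_real_derivative exp (- K * t) * (drift (x t) - K * I t)) (at t)"
      by (auto intro!: derivative_eq_intros simp: algebra_simps)
    moreover have "drift (x t) - K * I t \<ge> 0"
      using bound[OF inside[of t]] t by (simp add: I algebra_simps)
    ultimately show "\<exists>y. ((\<lambda>t. exp (- K * t) * I t) has_real_derivative y) (at t) \<and> 0 \<le> y"
      by (auto intro!: exI)
  next
    have "continuous_on {0..T} I"
      by (rule continuous_on_vector_derivative[OF I_deriv])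
    then show "continuous_on {0..T} (\<lambda>t. exp (- K * t) * I t)"
      by (intro continuous_intros)
  qed
  then have "I T \<ge> 0"
    by (simp add: I_def zero_le_mult_iff)
  then show ?thesis
    using I[of T] T x0[OF inside[of T]] by (simp add: M_def)
qed

text \<open>Height never increases, yet the endpoint is not below \<open>c\<close>. So no height is
  lost: the continuous, nonpositive drift has integral zero and vanishes along the whole trajectory,
  in particular at both ends.\<close>

lemma reach_min_level_necessary:
  assumes sign: "\<And>y. y \<in> P \<Longrightarrow> drift y \<le> 0" and min: "\<And>y. y \<in> F \<Longrightarrow> c \<le> \<beta> \<bullet> y"
    and reach: "reach A a B x0 P F" and x0: "\<beta> \<bullet> x0 \<le> c"
  shows "x0 \<in> F \<or> \<beta> \<bullet> x0 = c \<and> drift x0 = 0 \<and> (\<exists>y\<in>F. \<beta> \<bullet> y = c \<and> drift y = 0)"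
proof -
  obtain u T x where T: "T \<ge> 0" and sol: "is_solution A a B u x0 T x"
    and x: "x T \<in> F" "\<And>t. t \<in> {0..T} \<Longrightarrow> x t \<in> P"
    using reach unfolding reach_def by auto
  have start: "x 0 = x0" and cont: "continuous_on {0..T} x"
    using sol by (auto simp: is_solution_def)
  show ?thesis
  proof (cases "T = 0")
    case True
    then show ?thesis using x start by simp
  next
    case False
    have int: "((\<lambda>s. - drift (x s)) has_integral (\<beta> \<bullet> x0 - \<beta> \<bullet> x T)) {0..T}"
      using has_integral_neg[OF is_solution_height[OF sol, of T]] T by simp
    have "\<beta> \<bullet> x0 - \<beta> \<bullet> x T \<ge> 0"
      using has_integral_nonneg[OF int] sign x(2) by fastforce
    with x0 min[OF x(1)] have eq: "\<beta> \<bullet> x0 = c" "\<beta> \<bullet> x T = c" by simp_all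
    have "- drift (x t) = 0" if "t \<in> {0..T}" for t
    proof (rule has_integral_0_cbox_imp_0[of 0 T "\<lambda>s. - drift (x s)"])
      show "continuous_on (cbox 0 T) (\<lambda>s. - drift (x s))"
        using cont by (auto intro!: continuous_intros)
      show "((\<lambda>s. - drift (x s)) has_integral 0) (cbox 0 T)"
        using int eq by simp
    qed (use sign x(2) that T False in \<open>auto simp: less_imp_le\<close>)
    then have "drift x0 = 0" "drift (x T) = 0"
      using T start by force+
    then show ?thesis
      using eq x(1) by blast
  qed
qed

text \<open>A top face of equilibria above all of \<open>F\<close> traps every trajectory that
  starts on it; compactness provides such a starting point.\<close>

lemma reach_top_necessary:
  assumes "polytope P" and top: "\<And>y. y \<in> P \<Longrightarrow> (\<forall>z\<in>P. \<beta> \<bullet> z \<le> \<beta> \<bullet> y) \<Longrightarrow> drift y = 0 \<and> c < \<beta> \<bullet> y"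
    and F: "\<And>y. y \<in> F \<Longrightarrow> \<beta> \<bullet> y \<le> c" and "P \<noteq> {}"
  obtains x0 where "x0 \<in> P" "\<not> reach A a B x0 P F"
proof -
  have "continuous_on P (\<lambda>y. \<beta> \<bullet> y)"
    by (intro continuous_intros)
  then obtain x0 where x0: "x0 \<in> P" "\<And>y. y \<in> P \<Longrightarrow> \<beta> \<bullet> y \<le> \<beta> \<bullet> x0"
    using continuous_attains_sup[OF polytope_imp_compact[OF \<open>polytope P\<close>] \<open>P \<noteq> {}\<close>] by blast
  have "\<not> reach A a B x0 P F"
  proof
    assume "reach A a B x0 P F"
    then obtain u T x where T: "T \<ge> 0" and sol: "is_solution A a B u x0 T x"
      and x: "x T \<in> F" "\<And>t. t \<in> {0..T} \<Longrightarrow> x t \<in> P"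
      unfolding reach_def by auto
    have "\<beta> \<bullet> x T = \<beta> \<bullet> x0"
      using top x0 by (intro top_face_invariant[OF \<open>polytope P\<close> _ _ sol x(2) T]) auto
    then show False
      using top[OF x0(1)] x0 F[OF x(1)] by auto
  qed
  then show thesis
    using that x0 by blast
qed

section \<open>Sufficiency of the two conditions\<close>

text \<open>Levels up to the bottom of \<open>F\<close> are settled by \<open>low\<close>. Above
  them, a level with a point of negative drift can be left downwards, and a level without one can
  only be the top.\<close>

lemma reach_facet:
  assumes P: "convex P" "interior P \<noteq> {}"
    and sign: "\<And>y. y \<in> P \<Longrightarrow> drift y \<le> 0" and int: "\<And>y. y \<in> interior P \<Longrightarrow> drift y < 0"
    and F: "convex F" "F \<subseteq> P"
    and vm: "vm \<in> F" "\<And>y. y \<in> F \<Longrightarrow> \<beta> \<bullet> vm \<le> \<beta> \<bullet> y"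
    and vp: "vp \<in> F" "\<And>y. y \<in> F \<Longrightarrow> \<beta> \<bullet> y \<le> \<beta> \<bullet> vp"
    and level: "\<beta> \<bullet> vm = \<beta> \<bullet> vp \<Longrightarrow> \<exists>f\<in>F. drift f \<noteq> 0"
    and low: "\<And>y. y \<in> P \<Longrightarrow> \<beta> \<bullet> y \<le> \<beta> \<bullet> vm \<Longrightarrow> y \<notin> F \<Longrightarrow>
      \<beta> \<bullet> y = \<beta> \<bullet> vm \<and> drift y = 0 \<and> (\<exists>f\<in>F. \<beta> \<bullet> f = \<beta> \<bullet> vm \<and> drift f = 0)"
    and top: "p \<in> P" "\<And>y. y \<in> P \<Longrightarrow> \<beta> \<bullet> y \<le> \<beta> \<bullet> p" "drift p \<noteq> 0 \<or> \<beta> \<bullet> p \<le> \<beta> \<bullet> vp"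
    and x: "x \<in> P"
  shows "reach A a B x P F"
proof -
  have target: "reach A a B x P F" if "reach A a B x P {f}" "f \<in> F" for f
    using reach_mono[OF that(1)] that(2) by simp
  consider "\<beta> \<bullet> x \<le> \<beta> \<bullet> vm" | "\<beta> \<bullet> vm < \<beta> \<bullet> x" by linarith
  then show ?thesis
  proof cases
    case 1
    show ?thesis
    proof (cases "x \<in> F")
      case True
      then show ?thesis using x by (rule reach_refl[rotated])
    next
      case False
      from low[OF x 1 False] obtain f where "f \<in> F" "\<beta> \<bullet> f = \<beta> \<bullet> x" "drift f = 0" "drift x = 0"
        by auto
      then show ?thesis
        using target[of f] reach_level_equilibria[of P x f] P x F by auto
    qed
  next
    case 2
    show ?thesis
    proof (cases "\<exists>z\<in>P. \<beta> \<bullet> z = \<beta> \<bullet> x \<and> drift z < 0")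
      case True
      then obtain z where z: "z \<in> P" "drift z < 0" "\<beta> \<bullet> z = \<beta> \<bullet> x" by blast
      \<comment> \<open>The target must share its level with a point of negative drift. If
        \<open>F\<close> lies in one level, \<open>level\<close> gives a target that is such a point
        itself; otherwise a level strictly between the extremes of \<open>F\<close> and below
        \<open>x\<close> contains an interior point of \<open>P\<close>.\<close>
      obtain f zf where f: "f \<in> F" "\<beta> \<bullet> f < \<beta> \<bullet> x" and zf: "zf \<in> P" "drift zf < 0" "\<beta> \<bullet> zf = \<beta> \<bullet> f"
      proof (cases "\<beta> \<bullet> vm = \<beta> \<bullet> vp")
        case True
        then obtain f where f: "f \<in> F" "drift f \<noteq> 0"
          using level by blast
        moreover have "\<beta> \<bullet> f = \<beta> \<bullet> vm"
          using True vm(2) vp(2) f(1) by fastforce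
        ultimately show thesis
          using that[of f f] sign[of f] F(2) 2 by force
      next
        case False
        then have "\<beta> \<bullet> vm < min (\<beta> \<bullet> vp) (\<beta> \<bullet> x)"
          using vm(2)[OF vp(1)] 2 by simp
        then obtain c where c: "\<beta> \<bullet> vm < c" "c < \<beta> \<bullet> vp" "c < \<beta> \<bullet> x"
          using dense[of "\<beta> \<bullet> vm" "min (\<beta> \<bullet> vp) (\<beta> \<bullet> x)"] by auto
        obtain f where "f \<in> F" "\<beta> \<bullet> f = c"
          using connected_ivt_hyperplane[OF convex_connected[OF F(1)] vm(1) vp(1), of \<beta> c] c by auto
        moreover obtain zf where "zf \<in> interior P" "\<beta> \<bullet> zf = c"
          using convex_interior_level[OF P subsetD[OF F(2) vm(1)] x c(1,3)] by blast
        ultimately show thesis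
          using that[of f zf] c int[of zf] interior_subset[of P] by auto
      qed
      have "reach A a B x P {f}"
        using reach_lower_level[OF P(1) x sign[OF x] _ sign f(2) z zf] subsetD[OF F(2) f(1)] by simp
      then show ?thesis
        using target f(1) by blast
    next
      case False
      \<comment> \<open>A level strictly between those of \<open>vm\<close> and \<open>p\<close>
        meets the interior, where the drift is negative.\<close>
      have "\<beta> \<bullet> x = \<beta> \<bullet> p"
      proof (rule ccontr)
        assume "\<beta> \<bullet> x \<noteq> \<beta> \<bullet> p"
        then have "\<beta> \<bullet> x < \<beta> \<bullet> p" using top(2)[OF x] by simp
        then obtain z where "z \<in> interior P" "\<beta> \<bullet> z = \<beta> \<bullet> x"
          using convex_interior_level[OF P subsetD[OF F(2) vm(1)] top(1) 2] by blast
        then show False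
          using False int[of z] interior_subset[of P] by auto
      qed
      then have equil: "drift y = 0" if "y \<in> P" "\<beta> \<bullet> y = \<beta> \<bullet> x" for y
        using that False sign[of y] by force
      \<comment> \<open>\<open>p\<close> is itself an equilibrium, so \<open>top(3)\<close> forces
        \<open>F\<close> to touch the top level, and sliding to \<open>vp\<close> within that level
        finishes.\<close>
      then have "\<beta> \<bullet> p \<le> \<beta> \<bullet> vp"
        using top \<open>\<beta> \<bullet> x = \<beta> \<bullet> p\<close> by auto
      then have "\<beta> \<bullet> vp = \<beta> \<bullet> x"
        using top(2)[of vp] vp(1) F(2) \<open>\<beta> \<bullet> x = \<beta> \<bullet> p\<close> by force
      then have "reach A a B x P {vp}"
        using reach_level_equilibria[of P x vp] P x vp(1) F(2) equil[of x] equil[of vp] by auto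
      then show ?thesis
        using target vp(1) by blast
    qed
  qed
qed

end

section \<open>The characterisation for polytopes\<close>

theorem theorem1:
  fixes P F :: "(real^'n) set" and A :: "real^'n^'n" and a :: "real^'n"
    and B :: "real^'m^'n" and \<beta> v_minus v_plus :: "real^'n"
  defines "\<B> \<equiv> range (\<lambda>v. B *v v)"
  defines "\<O> \<equiv> {x. A *v x + a \<in> \<B>}"
  assumes P_poly: "polytope P" and P_dim: "aff_dim P = int CARD('n)"
    and A1: "rank B = CARD('n) - 1"
    and A2: "controllable A B"
    and A3: "interior P \<inter> \<O> = {}"
    and A4: "polytope F" "aff_dim F = int CARD('n) - 1" "F \<subseteq> frontier P"
    and beta_unit: "norm \<beta> = 1"
    and beta_normal: "\<forall>y\<in>\<B>. \<beta> \<bullet> y = 0"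
    and beta_sign: "\<forall>x\<in>P. \<beta> \<bullet> (A *v x + a) \<le> 0"
    and vm: "v_minus \<in> F" "\<forall>x\<in>F. \<beta> \<bullet> v_minus \<le> \<beta> \<bullet> x"
    and vp: "v_plus \<in> F" "\<forall>x\<in>F. \<beta> \<bullet> x \<le> \<beta> \<bullet> v_plus"
  shows "reach_set A a B P P F \<longleftrightarrow>
    (let H_minus = {x\<in>P. \<beta> \<bullet> x \<le> \<beta> \<bullet> v_minus};
         P_plus = {x\<in>P. \<forall>y\<in>P. \<beta> \<bullet> y \<le> \<beta> \<bullet> x};
         B_vm = {x. \<beta> \<bullet> x = \<beta> \<bullet> v_minus};
         B_minus = (if B_vm \<inter> \<O> \<inter> F \<noteq> {} then B_vm \<inter> \<O> else {})
     in H_minus - (F \<union> B_minus) = {} \<and>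
        \<not> (P_plus \<subseteq> \<O> \<inter> {x\<in>P. \<beta> \<bullet> x > \<beta> \<bullet> v_plus}))"
proof -
  have "\<beta> \<noteq> 0" using beta_unit by auto
  have "dim (range (\<lambda>v. B *v v)) = CARD('n) - 1"
    using A1 by (simp add: rank_dim_range)
  \<comment> \<open>A subspace of dimension \<open>CARD('n) - 1\<close> inside the hyperplane
    orthogonal to \<beta> is all of it.\<close>
  then have "range (\<lambda>v. B *v v) = {y. \<beta> \<bullet> y = 0}"
    using beta_normal dim_hyperplane[OF \<open>\<beta> \<noteq> 0\<close>]
    by (intro subspace_dim_equal subspace_hyperplane linear_subspace_image subspace_UNIV)
      (auto simp: \<B>_def matrix_vector_mul_linear)
  then interpret codim_one_input A a B \<beta>
    by unfold_locales
  have \<O>: "\<O> = {x. drift x = 0}"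
    unfolding \<O>_def \<B>_def drift_zero_iff ..
  have sign: "drift y \<le> 0" if "y \<in> P" for y
    using beta_sign that by (simp add: drift_def)
  have int: "drift y < 0" if "y \<in> interior P" for y
    using sign[of y] that A3 interior_subset[of P] by (force simp: \<O>)
  have P: "convex P" "closed P" "interior P \<noteq> {}"
    using P_poly P_dim interior_rel_interior_gen[of P] rel_interior_eq_empty[of P]
    by (auto simp: polytope_imp_convex polytope_imp_closed)
  have F: "convex F" "F \<subseteq> P"
    using A4 P(2) by (auto simp: polytope_imp_convex frontier_def)
  \<comment> \<open>\<open>?low\<close> and \<open>?top\<close> are conditions (a) and (b) spelled
    out pointwise; the nonemptiness test in \<open>B_minus\<close> becomes the witness
    \<open>f\<close>.\<close>
  let ?low = "\<forall>y\<in>P. \<beta> \<bullet> y \<le> \<beta> \<bullet> v_minus \<longrightarrow> y \<notin> F \<longrightarrow>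
      \<beta> \<bullet> y = \<beta> \<bullet> v_minus \<and> drift y = 0 \<and> (\<exists>f\<in>F. \<beta> \<bullet> f = \<beta> \<bullet> v_minus \<and> drift f = 0)"
  let ?top = "\<exists>p\<in>P. (\<forall>y\<in>P. \<beta> \<bullet> y \<le> \<beta> \<bullet> p) \<and> (drift p \<noteq> 0 \<or> \<beta> \<bullet> p \<le> \<beta> \<bullet> v_plus)"
  have "reach_set A a B P P F \<longleftrightarrow> ?low \<and> ?top"
  proof
    assume reach: "reach_set A a B P P F"
    then have ?low
      using reach_min_level_necessary[where P = P and F = F and c = "\<beta> \<bullet> v_minus", OF sign] vm(2)
      unfolding reach_set_def by blast
    moreover have ?top
    proof (rule ccontr)
      assume "\<not> ?top"
      then have "\<And>y. y \<in> P \<Longrightarrow> (\<forall>z\<in>P. \<beta> \<bullet> z \<le> \<beta> \<bullet> y) \<Longrightarrow> drift y = 0 \<and> \<beta> \<bullet> v_plus < \<beta> \<bullet> y"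
        by (meson not_le)
      from reach_top_necessary[where F = F, OF P_poly this] vp vm(1) F(2) reach show False
        unfolding reach_set_def by blast
    qed
    ultimately show "?low \<and> ?top" ..
  next
    assume "?low \<and> ?top"
    then obtain p where low: ?low and p: "p \<in> P" "\<And>y. y \<in> P \<Longrightarrow> \<beta> \<bullet> y \<le> \<beta> \<bullet> p"
      "drift p \<noteq> 0 \<or> \<beta> \<bullet> p \<le> \<beta> \<bullet> v_plus"
      by blast
    \<comment> \<open>Here \<open>F\<close> lies in a single level, and controllability keeps it
      from consisting of equilibria.\<close>
    have "\<exists>f\<in>F. drift f \<noteq> 0" if "\<beta> \<bullet> v_minus = \<beta> \<bullet> v_plus"
    proof -
      have "\<beta> \<bullet> y = \<beta> \<bullet> v_plus" if "y \<in> F" for y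
        using vm(2) vp(2) that \<open>\<beta> \<bullet> v_minus = \<beta> \<bullet> v_plus\<close> by fastforce
      from level_set_not_equilibria[OF A2 A4(2) this \<open>\<beta> \<noteq> 0\<close>] show ?thesis
        by blast
    qed
    then show "reach_set A a B P P F"
      unfolding reach_set_def
      using reach_facet[OF P(1,3) sign int F vm(1) _ vp(1) _ _ _ p] vm(2) vp(2) low by blast
  qed
  also have "?low \<and> ?top \<longleftrightarrow>
    (let H_minus = {x\<in>P. \<beta> \<bullet> x \<le> \<beta> \<bullet> v_minus};
         P_plus = {x\<in>P. \<forall>y\<in>P. \<beta> \<bullet> y \<le> \<beta> \<bullet> x};
         B_vm = {x. \<beta> \<bullet> x = \<beta> \<bullet> v_minus};
         B_minus = (if B_vm \<inter> \<O> \<inter> F \<noteq> {} then B_vm \<inter> \<O> else {})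
     in H_minus - (F \<union> B_minus) = {} \<and>
        \<not> (P_plus \<subseteq> \<O> \<inter> {x\<in>P. \<beta> \<bullet> x > \<beta> \<bullet> v_plus}))"
  proof -
    have low: "?low \<longleftrightarrow> {x\<in>P. \<beta> \<bullet> x \<le> \<beta> \<bullet> v_minus} - (F \<union> (if {x. \<beta> \<bullet> x = \<beta> \<bullet> v_minus} \<inter> \<O> \<inter> F \<noteq> {}
        then {x. \<beta> \<bullet> x = \<beta> \<bullet> v_minus} \<inter> \<O> else {})) = {}"
      by (auto simp: \<O>)
    have top: "?top \<longleftrightarrow> \<not> ({x\<in>P. \<forall>y\<in>P. \<beta> \<bullet> y \<le> \<beta> \<bullet> x} \<subseteq> \<O> \<inter> {x\<in>P. \<beta> \<bullet> x > \<beta> \<bullet> v_plus})"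
      by (auto simp: \<O> not_less)
    show ?thesis
      unfolding Let_def low top ..
  qed
  finally show ?thesis .
qed

end
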